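(* Let $R$ be a linear commutative ring with unity, let $n\in\mathbb{N}$ with $n\geq 1$, and let $f_{1},\ldots,f_{n+1}\colon R\to R$ be additive functions such that $f_{i}(1)=0$ for all $i=1,\ldots,n+1$. Then the functional equation $$\sum_{i=0}^{n}\frac{1}{\binom{n+1}{i}}\sum_{\mathrm{card}(I)=i}\left(\prod_{j\in I}x_{j}\right)\cdot f_{n+1-i}\left(\prod_{k\in\{1,\ldots,n+1\}\setminus I}x_{k}\right)=0$$ holds for all $x_1,\ldots,x_{n+1}\in R$ if and only if there exist $D_{j}\in\mathscr{D}_{j}(R)$ $(j=0,\ldots,n)$ such that $$f_{n+1-i}=(-1)^{i}\sum_{k=0}^{i}\binom{n+1-i+k}{k}D_{n-i+k}\qquad (i=0,\ldots,n).$$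
   Context: A commutative unitary ring $R$ is called linear if it is a linear space over the field $\mathbb{Q}$ of rationals. A mapping $f\colon R\to R$ is additive if $f(x+y)=f(x)+f(y)$ for all $x,y\in R$. Higher order derivations: let $R$ be a ring. The identically zero map is the only derivation of order zero. For each integer $n\ge 1$, an additive mapping $f\colon R\to R$ is a derivation of order $n$ if there exists $B\colon R\times R\to R$ such that $B$ is a bi-derivation of order $n-1$ (that is, $B$ is a derivation of order $n-1$ in each variable, the other variable being fixed) and $f(xy)-xf(y)-f(x)y=B(x,y)$ for all $x,y\in R$. The set of derivations of order $n$ of $R$ is denoted by $\mathscr{D}_{n}(R)$. The inner sum runs over all subsets $I\subset\{1,\ldots,n+1\}$ of cardinality $i$; an empty product equals $1$. *)

theory Defs
  imports Complex_Main
begin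

primrec derivation_of_order :: "nat \<Rightarrow> ('a::ring \<Rightarrow> 'a) \<Rightarrow> bool" where
  "derivation_of_order 0 f \<longleftrightarrow> (\<forall>x. f x = 0)"
| "derivation_of_order (Suc n) f \<longleftrightarrow>
     additive f \<and>
     (\<exists>B :: 'a \<Rightarrow> 'a \<Rightarrow> 'a.
        (\<forall>y. derivation_of_order n (\<lambda>x. B x y)) \<and>
        (\<forall>x. derivation_of_order n (\<lambda>y. B x y)) \<and>
        (\<forall>x y. f (x * y) - x * f y - f x * y = B x y))"

definition derivations :: "nat \<Rightarrow> ('a::ring \<Rightarrow> 'a) set" where
  "derivations n = {f. derivation_of_order n f}"

end

theory Submission imports Defs begin

text \<open>
  Write \<open>N = n + 1\<close> and let \<open>\<Delta>\<^sub>y f (x) = f (x y) - y f (x)\<close>. These operators commute, and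
  \<open>\<D>\<^sub>m(R)\<close> consists of the additive \<open>f\<close> with \<open>f 1 = 0\<close> that are differential operators of
  order at most \<open>m\<close>, that is, are annihilated by all \<open>(m + 1)\<close>-fold products of the \<open>\<Delta>\<^sub>y\<close>.
  Binomial inversion gives unique maps \<open>e\<^sub>s\<close> with
  \<open>f\<^sub>N\<^sub>-\<^sub>i = (N choose i) \<Sum>\<^sub>s\<^sub>\<le>\<^sub>i (-1)\<^sup>i\<^sup>-\<^sup>s (i choose s) e\<^sub>s\<close>, and the left-hand side of the functional
  equation becomes \<open>\<Sum>\<^sub>S (\<Prod>\<^sub>j\<^sub>\<in>\<^sub>S x\<^sub>j) (\<Delta>\<^sub>S\<^sub>c e\<^sub>|\<^sub>S\<^sub>|)(1)\<close>, where \<open>S\<close> runs over the subsets of \<open>{1..N}\<close>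
  and \<open>Sc\<close> is the complement of \<open>S\<close>. Since \<open>\<Delta>\<^sub>1 = 0\<close>, putting some of the variables equal to 1
  separates the summands, so the equation holds iff every \<open>e\<^sub>s\<close> is a differential operator of
  order at most \<open>n - s\<close>. Finally \<open>D\<^sub>n\<^sub>-\<^sub>s = (-1)\<^sup>s (N choose s) e\<^sub>s\<close>.
\<close>

section \<open>Derivations as differential operators\<close>

text \<open>Differential operators in Grothendieck's sense, of order strictly less than the index.\<close>

primrec diffop :: "nat \<Rightarrow> ('a::comm_ring \<Rightarrow> 'a) \<Rightarrow> bool" where
  "diffop 0 f \<longleftrightarrow> (\<forall>x. f x = 0)"
| "diffop (Suc m) f \<longleftrightarrow> (\<forall>y. diffop m (\<lambda>x. f (x * y) - y * f x))"

lemma diffop_zero: "diffop m (\<lambda>x. 0)"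
  by (induction m) auto

lemma diffop_add:
  assumes "diffop m f" "diffop m g"
  shows "diffop m (\<lambda>x. f x + g x)"
  using assms
proof (induction m arbitrary: f g)
  case (Suc m)
  have "diffop m (\<lambda>x. (f (x * y) - y * f x) + (g (x * y) - y * g x))" for y
    using Suc by auto
  then show ?case
    by (simp add: algebra_simps)
qed auto

lemma diffop_mult_left: "diffop (Suc m) (\<lambda>x. c * x)"
  by (simp add: diffop_zero algebra_simps)

text \<open>Induction on \<open>m\<close>. For fixed \<open>y\<close>, the defect
  \<open>B x y\<close> differs from the commutator \<open>f (x * y) - y * f x\<close> only by the
  multiplication \<open>f y * x\<close>, a differential operator of order zero, so both satisfy
  \<open>diffop (Suc m)\<close> or neither does. As \<open>B\<close> is symmetric, one variable
  suffices.\<close>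

lemma derivation_of_order_iff_diffop:
  fixes f :: "'a::{comm_ring, comm_monoid_mult} \<Rightarrow> 'a"
  shows "derivation_of_order m f \<longleftrightarrow> additive f \<and> f 1 = 0 \<and> diffop (Suc m) f"
proof (induction m arbitrary: f)
  case 0
  show ?case
  proof
    assume "derivation_of_order 0 f"
    then show "additive f \<and> f 1 = 0 \<and> diffop (Suc 0) f"
      by (simp add: additive_def)
  next
    assume f: "additive f \<and> f 1 = 0 \<and> diffop (Suc 0) f"
    have "f x = 0" for x
    proof -
      have "f (1 * x) - x * f 1 = 0"
        using f unfolding diffop.simps by blast
      then show ?thesis
        using f by simp
    qed
    then show "derivation_of_order 0 f"
      by simp
  qed
next
  case (Suc m)
  define B where "B x y = f (x * y) - x * f y - f x * y" for x y
  have B_commute: "B x y = B y x" for x y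
    by (simp add: B_def algebra_simps)
  have B_diffop: "diffop (Suc m) (\<lambda>x. B x y) \<longleftrightarrow> diffop (Suc m) (\<lambda>x. f (x * y) - y * f x)" for y
  proof
    assume "diffop (Suc m) (\<lambda>x. B x y)"
    then have "diffop (Suc m) (\<lambda>x. B x y + f y * x)"
      by (intro diffop_add diffop_mult_left)
    also have "(\<lambda>x. B x y + f y * x) = (\<lambda>x. f (x * y) - y * f x)"
      by (simp add: fun_eq_iff B_def mult.commute)
    finally show "diffop (Suc m) (\<lambda>x. f (x * y) - y * f x)" .
  next
    assume "diffop (Suc m) (\<lambda>x. f (x * y) - y * f x)"
    then have "diffop (Suc m) (\<lambda>x. f (x * y) - y * f x + (- f y) * x)"
      by (intro diffop_add diffop_mult_left)
    also have "(\<lambda>x. f (x * y) - y * f x + (- f y) * x) = (\<lambda>x. B x y)"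
      by (simp add: fun_eq_iff B_def mult.commute)
    finally show "diffop (Suc m) (\<lambda>x. B x y)" .
  qed
  show ?case
  proof
    assume "derivation_of_order (Suc m) f"
    then obtain B' where add: "additive f" and B': "\<And>y. derivation_of_order m (\<lambda>x. B' x y)"
      and "\<forall>x y. f (x * y) - x * f y - f x * y = B' x y"
      unfolding derivation_of_order.simps by blast
    then have "B' = B"
      by (simp add: fun_eq_iff B_def)
    then have B: "B 1 y = 0" "diffop (Suc m) (\<lambda>x. B x y)" for y
      using B' unfolding Suc.IH by blast+
    \<comment> \<open>Since \<open>B 1 1 = - f 1\<close>, normalisation at 1 passes from
      \<open>B\<close> to \<open>f\<close>.\<close>
    have "f 1 = 0"
      using B(1)[of 1] by (simp add: B_def)
    moreover have "diffop (Suc (Suc m)) f"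
      unfolding diffop.simps(2)[of "Suc m"] using B(2) B_diffop by blast
    ultimately show "additive f \<and> f 1 = 0 \<and> diffop (Suc (Suc m)) f"
      using add by blast
  next
    assume f: "additive f \<and> f 1 = 0 \<and> diffop (Suc (Suc m)) f"
    have B: "derivation_of_order m (\<lambda>x. B x y)" for y
      unfolding Suc.IH
    proof (intro conjI)
      show "additive (\<lambda>x. B x y)"
        using f by (simp add: B_def additive_def algebra_simps del: diffop.simps)
      show "B 1 y = 0"
        using f by (simp add: B_def del: diffop.simps)
      show "diffop (Suc m) (\<lambda>x. B x y)"
        unfolding B_diffop using f diffop.simps(2)[of "Suc m"] by blast
    qed
    moreover have "derivation_of_order m (\<lambda>y. B x y)" for x
      using B[of x] unfolding B_commute[of _ x] .
    ultimately show "derivation_of_order (Suc m) f"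
      using f B_def unfolding derivation_of_order.simps by metis
  qed
qed

section \<open>Iterated commutators over the rationals\<close>

text \<open>Scaling is an abstract vector space structure. It commutes with ring multiplication
  because multiplication by a fixed element is additive, hence linear over the rationals.\<close>

locale linear_ring = vector_space scale
  for scale :: "rat \<Rightarrow> 'a::{comm_ring, comm_monoid_mult} \<Rightarrow> 'a"
begin

text \<open>Natural and integer scalars follow from additivity. For \<open>q = a / b\<close>, both
  sides agree after scaling by \<open>b\<close>, which is nonzero and cancels.\<close>

lemma additive_scale:
  assumes "additive (g :: 'a \<Rightarrow> 'a)"
  shows "g (scale q x) = scale q (g x)"
proof -
  interpret additive g by fact
  have of_nat: "g (scale (of_nat k) y) = scale (of_nat k) (g y)" for k y
    by (induction k) (auto simp: zero add scale_left_distrib)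
  have of_int: "g (scale (of_int k) y) = scale (of_int k) (g y)" for k y
    by (cases k rule: int_cases2) (auto simp: of_nat minus)
  obtain a b where q: "q = of_int a / of_int b" "b > 0"
    by (metis quotient_of_div quotient_of_denom_pos surj_pair)
  have "scale (of_int b) (g (scale q x)) = g (scale (of_int b) (scale q x))"
    by (simp only: of_int)
  also have "\<dots> = scale (of_int a) (g x)"
    using q by (simp add: of_int)
  also have "\<dots> = scale (of_int b) (scale q (g x))"
    using q by simp
  finally show ?thesis
    using q by (simp add: scale_cancel_left del: scale_scale)
qed

lemma mult_scale_right: "y * scale q x = scale q (y * x)"
  by (rule additive_scale) (simp add: additive_def algebra_simps)

lemma additive_scale_comp: "additive g \<Longrightarrow> additive (\<lambda>x. scale q (g x))"
  by (simp add: additive_def scale_right_distrib)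

lemma additive_sum_maps: "(\<And>i. i \<in> I \<Longrightarrow> additive (g i)) \<Longrightarrow> additive (\<lambda>x. \<Sum>i\<in>I. g i x :: 'a)"
  by (simp add: additive_def sum.distrib)

lemma diffop_scale:
  assumes "diffop m (g :: 'a \<Rightarrow> 'a)"
  shows "diffop m (\<lambda>x. scale q (g x))"
  using assms
proof (induction m arbitrary: g)
  case (Suc m)
  then show ?case
    by (simp add: mult_scale_right flip: scale_right_diff_distrib)
qed simp

lemma derivations_scale:
  "g \<in> derivations m \<Longrightarrow> (\<lambda>x. scale q (g x)) \<in> derivations m"
  by (simp add: derivations_def derivation_of_order_iff_diffop additive_scale_comp diffop_scale
      del: diffop.simps)

text \<open>The product of the operators \<open>g \<mapsto> (\<lambda>z. g (z * x a) - x a * g z)\<close> over \<open>a \<in> A\<close>, applied to \<open>g\<close>.\<close>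

definition commutator :: "('i \<Rightarrow> 'a) \<Rightarrow> 'i set \<Rightarrow> ('a \<Rightarrow> 'a) \<Rightarrow> 'a \<Rightarrow> 'a" where
  "commutator x A g z =
     (\<Sum>K\<in>Pow A. scale ((-1) ^ card K) (prod x K * g (prod x (A - K) * z)))"

lemma commutator_empty: "commutator x {} g z = g z"
  by (simp add: commutator_def)

lemma commutator_cong:
  assumes "\<And>a. a \<in> A \<Longrightarrow> x a = y a"
  shows "commutator x A g z = commutator y A g z"
proof -
  have "prod x K = prod y K" if "K \<subseteq> A" for K
    using that assms by (intro prod.cong) auto
  then show ?thesis
    unfolding commutator_def by (intro sum.cong) auto
qed

text \<open>Subsets without \<open>a\<close> contribute the evaluation at \<open>z * x a\<close>;
  subsets containing \<open>a\<close> contribute the factor \<open>- x a\<close>. Thus the explicit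
  sum is an iterated commutator.\<close>

lemma commutator_insert:
  assumes "finite A" "a \<notin> A"
  shows "commutator x (insert a A) g z = commutator x A g (z * x a) - x a * commutator x A g z"
proof -
  let ?t = "\<lambda>K. scale ((-1) ^ card K) (prod x K * g (prod x (insert a A - K) * z))"
  have "commutator x (insert a A) g z = sum ?t (Pow A) + sum ?t (insert a ` Pow A)"
    unfolding commutator_def Pow_insert using assms by (intro sum.union_disjoint) auto
  also have "sum ?t (Pow A) = commutator x A g (z * x a)"
    unfolding commutator_def
  proof (intro sum.cong refl)
    fix K assume "K \<in> Pow A"
    then have "insert a A - K = insert a (A - K)"
      using assms by auto
    then show "?t K = scale ((-1) ^ card K) (prod x K * g (prod x (A - K) * (z * x a)))"
      using assms by (simp add: mult_ac)
  qed
  also have "sum ?t (insert a ` Pow A) = (\<Sum>K\<in>Pow A. ?t (insert a K))"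
    using assms by (intro sum.reindex_cong[OF _ refl refl]) (auto simp: inj_on_def)
  also have "\<dots> = - (x a * commutator x A g z)"
    unfolding commutator_def sum_distrib_left sum_negf[symmetric]
  proof (intro sum.cong refl)
    fix K assume "K \<in> Pow A"
    then have K: "finite K" "a \<notin> K" "insert a A - insert a K = A - K"
      using assms by (auto intro: finite_subset)
    then show "?t (insert a K) =
        - (x a * scale ((-1) ^ card K) (prod x K * g (prod x (A - K) * z)))"
      by (simp add: mult_scale_right mult.assoc)
  qed
  finally show ?thesis
    by simp
qed

text \<open>The operators commute, so the one for \<open>a\<close> may act first; this matches the
  recursion of \<open>diffop\<close>.\<close>

lemma commutator_insert_map:
  assumes "finite A" "a \<notin> A"
  shows "commutator x (insert a A) g z = commutator x A (\<lambda>z. g (z * x a) - x a * g z) z"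
  unfolding commutator_insert[OF assms]
  by (simp add: commutator_def sum_distrib_left mult_scale_right right_diff_distrib
      scale_right_diff_distrib sum_subtractf mult_ac)

lemma commutator_eq_0_if_one:
  assumes "finite A" "a \<in> A" "x a = 1"
  shows "commutator x A g z = 0"
proof -
  have "commutator x (insert a (A - {a})) g z = 0"
    using assms by (subst commutator_insert) auto
  then show ?thesis
    using assms by (simp add: insert_absorb)
qed

lemma commutator_eq_0_if_diffop:
  assumes "finite A" "diffop (card A) g"
  shows "commutator x A g z = 0"
  using assms
proof (induction A arbitrary: g z rule: finite_induct)
  case (insert a A)
  then show ?case
    by (simp add: commutator_insert_map)
qed (simp add: commutator_empty)

lemma diffop_if_commutator_eq_0:
  fixes A :: "'i set"
  assumes "finite A" "\<And>x z. commutator x A g z = 0"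
  shows "diffop (card A) g"
  using assms
proof (induction A arbitrary: g rule: finite_induct)
  case (insert a A)
  have "commutator x A (\<lambda>z. g (z * y) - y * g z) z = 0" for x y z
  proof -
    \<comment> \<open>As \<open>a\<close> lies outside \<open>A\<close>, the value of
      \<open>x\<close> there is free and can be set to \<open>y\<close>.\<close>
    have "commutator x A (\<lambda>z. g (z * y) - y * g z) z =
        commutator (x(a := y)) A (\<lambda>z. g (z * y) - y * g z) z"
      using insert.hyps by (intro commutator_cong) auto
    also have "\<dots> = 0"
      using commutator_insert_map[OF insert.hyps(1,2), of "x(a := y)" g z] insert.prems by simp
    finally show ?thesis .
  qed
  then show ?case
    using insert.hyps insert.IH by simp
qed (simp add: commutator_empty)

text \<open>
  Vanishing at 1 suffices: \<open>h = commutator x A g\<close> then satisfies \<open>h y = y * h 1\<close> for all \<open>y\<close>.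
\<close>

lemma diffop_if_commutator_eq_0_at_1:
  fixes A :: "'i set"
  assumes "finite A" "A \<noteq> {}" "\<And>x. commutator x A g 1 = 0"
  shows "diffop (card A) g"
proof (rule diffop_if_commutator_eq_0[OF assms(1)])
  fix x :: "'i \<Rightarrow> 'a" and z
  obtain a A' where A: "A = insert a A'" "a \<notin> A'"
    using assms(2) by (metis all_not_in_conv mk_disjoint_insert)
  have fin: "finite A'"
    using A assms(1) by simp
  have linear: "commutator x A' g y = y * commutator x A' g 1" for y
  proof -
    have "commutator (x(a := y)) A' g w = commutator x A' g w" for w
      using A by (intro commutator_cong) auto
    then show ?thesis
      using assms(3)[of "x(a := y)"] A fin by (simp add: commutator_insert)
  qed
  show "commutator x A g z = 0"
    using A fin linear[of "z * x a"] linear[of z] by (simp add: commutator_insert mult_ac)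
qed

section \<open>The functional equation in terms of commutators\<close>

lemma sum_Pow_by_card:
  assumes "finite J"
  shows "(\<Sum>S\<in>Pow J. h (card S)) = (\<Sum>s\<le>card J. scale (of_nat (card J choose s)) (h s :: 'a))"
proof -
  have "(\<Sum>S\<in>Pow J. h (card S)) = (\<Sum>s\<le>card J. \<Sum>S | S \<in> Pow J \<and> card S = s. h (card S))"
    using assms by (intro sum.group[symmetric]) (auto intro: card_mono)
  also have "\<dots> = (\<Sum>s\<le>card J. \<Sum>S | S \<subseteq> J \<and> card S = s. h s)"
    by (intro sum.cong) auto
  also have "\<dots> = (\<Sum>s\<le>card J. scale (of_nat (card J choose s)) (h s))"
    using assms by (simp add: n_subsets sum_constant_scale)
  finally show ?thesis .
qed

text \<open>Expanding the commutators gives pairs of \<open>S\<close> and a disjoint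
  \<open>K\<close>. Put \<open>J = S \<union> K\<close>, exchange the sums, and group the subsets
  \<open>S\<close> of \<open>J\<close> by cardinality.\<close>

lemma sum_commutators_eq:
  assumes "finite A"
  shows "(\<Sum>S\<in>Pow A. prod x S * commutator x (A - S) (e (card S)) 1) =
    (\<Sum>J\<in>Pow A. prod x J * (\<Sum>s\<le>card J.
       scale ((-1) ^ (card J - s) * of_nat (card J choose s)) (e s (prod x (A - J)))))"
proof -
  let ?t = "\<lambda>S J. scale ((-1) ^ (card J - card S)) (prod x J * e (card S) (prod x (A - J)))"
  have fin: "finite S" if "S \<subseteq> A" for S
    using that assms by (rule finite_subset)
  have "prod x S * commutator x (A - S) (e (card S)) 1 = (\<Sum>J | J \<in> Pow A \<and> S \<subseteq> J. ?t S J)"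
    if S: "S \<in> Pow A" for S
    unfolding commutator_def sum_distrib_left
  proof (rule sum.reindex_bij_witness[of _ "\<lambda>J. J - S" "\<lambda>K. S \<union> K"])
    fix K assume K: "K \<in> Pow (A - S)"
    then have "prod x (S \<union> K) = prod x S * prod x K" "card (S \<union> K) = card S + card K"
      using S fin by (auto intro!: prod.union_disjoint card_Un_disjoint)
    moreover have "A - (S \<union> K) = A - S - K"
      by auto
    ultimately show "?t S (S \<union> K) =
        prod x S * scale ((-1) ^ card K) (prod x K * e (card S) (prod x (A - S - K) * 1))"
      by (simp add: mult_scale_right mult.assoc)
  qed (use S in auto)
  then have "(\<Sum>S\<in>Pow A. prod x S * commutator x (A - S) (e (card S)) 1) =
      (\<Sum>S\<in>Pow A. \<Sum>J | J \<in> Pow A \<and> S \<subseteq> J. ?t S J)"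
    by (intro sum.cong) auto
  also have "\<dots> = (\<Sum>J\<in>Pow A. \<Sum>S | S \<in> Pow A \<and> S \<subseteq> J. ?t S J)"
    using assms by (intro sum.swap_restrict) auto
  also have "\<dots> = (\<Sum>J\<in>Pow A. prod x J * (\<Sum>s\<le>card J.
       scale ((-1) ^ (card J - s) * of_nat (card J choose s)) (e s (prod x (A - J)))))"
  proof (intro sum.cong refl)
    fix J assume J: "J \<in> Pow A"
    then have "{S. S \<in> Pow A \<and> S \<subseteq> J} = Pow J"
      by auto
    then have "(\<Sum>S | S \<in> Pow A \<and> S \<subseteq> J. ?t S J) = (\<Sum>S\<in>Pow J. ?t S J)"
      by simp
    also have "\<dots> = (\<Sum>s\<le>card J. scale (of_nat (card J choose s))
        (scale ((-1) ^ (card J - s)) (prod x J * e s (prod x (A - J)))))"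
      using J fin by (intro sum_Pow_by_card) auto
    finally show "(\<Sum>S | S \<in> Pow A \<and> S \<subseteq> J. ?t S J) = prod x J * (\<Sum>s\<le>card J.
        scale ((-1) ^ (card J - s) * of_nat (card J choose s)) (e s (prod x (A - J))))"
      by (simp add: sum_distrib_left mult_scale_right mult.commute)
  qed
  finally show ?thesis .
qed

text \<open>Forward, strong induction on \<open>T\<close> isolates the summand with
  \<open>S = A - T\<close>. Conversely, each summand with \<open>S \<noteq> A\<close> vanishes by
  its order bound, and the one with \<open>S = A\<close> by \<open>e1\<close>.\<close>

lemma sum_commutators_eq_0_iff:
  fixes A :: "'i set"
  assumes "finite A" and e1: "\<And>s. e s 1 = 0"
  shows "(\<forall>x. (\<Sum>S\<in>Pow A. prod x S * commutator x (A - S) (e (card S)) 1) = 0) \<longleftrightarrow>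
    (\<forall>s<card A. diffop (card A - s) (e s))" (is "?L \<longleftrightarrow> ?R")
proof
  assume L: ?L
  have vanish: "commutator x T (e (card A - card T)) 1 = 0" if "T \<subseteq> A" for T x
  proof -
    have "finite T"
      using that assms(1) by (rule finite_subset)
    then show ?thesis
      using that
    proof (induction T arbitrary: x rule: finite_psubset_induct)
      case (psubset T)
      \<comment> \<open>Setting the variables outside \<open>T\<close> to 1 kills each summand with
        \<open>A - S\<close> not inside \<open>T\<close>; proper subsets of \<open>T\<close> are
        handled by the induction hypothesis.\<close>
      define y where "y = (\<lambda>a. if a \<in> T then x a else 1)"
      have "prod y S * commutator y (A - S) (e (card S)) 1 = 0" if S: "S \<in> Pow A - {A - T}" for S
      proof (cases "A - S \<subseteq> T")
        case True
        then have "A - S \<subset> T"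
          using S psubset.prems by blast
        moreover have "card A - card (A - S) = card S"
          using S assms(1) card_mono[of A S] finite_subset[of S A] by (simp add: card_Diff_subset)
        ultimately show ?thesis
          using psubset.IH[of "A - S" y] by simp
      next
        case False
        then obtain a where "a \<in> A - S" "a \<notin> T"
          by auto
        then show ?thesis
          using assms(1) commutator_eq_0_if_one[of "A - S" a y] by (simp add: y_def)
      qed
      then have "(\<Sum>S\<in>Pow A. prod y S * commutator y (A - S) (e (card S)) 1) =
          prod y (A - T) * commutator y (A - (A - T)) (e (card (A - T))) 1"
        using assms(1) by (subst sum.remove[of _ "A - T"]) auto
      also have "prod y (A - T) = 1"
        by (simp add: y_def)
      also have "A - (A - T) = T"
        using psubset.prems by auto
      also have "card (A - T) = card A - card T"
        using psubset by (simp add: card_Diff_subset)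
      also have "commutator y T (e (card A - card T)) 1 = commutator x T (e (card A - card T)) 1"
        by (intro commutator_cong) (simp add: y_def)
      finally show ?case
        using L by simp
    qed
  qed
  show ?R
  proof (intro allI impI)
    fix s assume s: "s < card A"
    \<comment> \<open>The strict bound on \<open>s\<close> makes \<open>T\<close> nonempty, as the
      test at 1 requires.\<close>
    obtain T where T: "T \<subseteq> A" "card T = card A - s"
      using obtain_subset_with_card_n[of "card A - s" A] by auto
    moreover have "finite T" "T \<noteq> {}"
      using T s assms(1) by (auto intro: finite_subset)
    ultimately show "diffop (card A - s) (e s)"
      using diffop_if_commutator_eq_0_at_1[of T "e s"] vanish[of T] s by simp
  qed
next
  assume R: ?R
  show ?L
  proof (intro allI sum.neutral ballI)
    fix x :: "'i \<Rightarrow> 'a" and S assume S: "S \<in> Pow A"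
    show "prod x S * commutator x (A - S) (e (card S)) 1 = 0"
    proof (cases "S = A")
      case True
      then show ?thesis
        by (simp add: commutator_empty e1)
    next
      case False
      then have "card S < card A"
        using S assms(1) by (simp add: psubset_card_mono psubsetI)
      moreover have "card (A - S) = card A - card S"
        using S assms(1) by (simp add: card_Diff_subset finite_subset)
      ultimately have "commutator x (A - S) (e (card S)) 1 = 0"
        using R assms(1) by (intro commutator_eq_0_if_diffop) auto
      then show ?thesis
        by simp
    qed
  qed
qed

section \<open>Binomial inversion\<close>

text \<open>Factoring out \<open>i choose j\<close> and shifting the index by \<open>j\<close>
  leaves the binomial expansion of \<open>(1 - 1) ^ (i - j)\<close>, with
  \<open>0 ^ 0 = 1\<close>.\<close>

lemma sum_choose_mult_choose:
  fixes i j :: nat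
  assumes "j \<le> i"
  shows "(\<Sum>s=j..i. (-1) ^ (i - s) * of_nat (i choose s) * of_nat (s choose j)) =
    (if i = j then 1 else 0 :: rat)"
proof -
  have "(\<Sum>s=j..i. (-1) ^ (i - s) * of_nat (i choose s) * of_nat (s choose j)) =
      (\<Sum>s=j..i. of_nat (i choose j) * ((-1) ^ (i - s) * of_nat ((i - j) choose (s - j)) :: rat))"
  proof (intro sum.cong refl)
    fix s assume "s \<in> {j..i}"
    then have "of_nat (i choose s) * of_nat (s choose j) =
        (of_nat (i choose j) * of_nat ((i - j) choose (s - j)) :: rat)"
      by (simp add: choose_mult flip: of_nat_mult)
    then show "(-1) ^ (i - s) * of_nat (i choose s) * of_nat (s choose j) =
        of_nat (i choose j) * ((-1) ^ (i - s) * of_nat ((i - j) choose (s - j)) :: rat)"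
      by (metis mult.assoc mult.commute)
  qed
  also have "\<dots> = of_nat (i choose j) *
      (\<Sum>t\<le>i - j. (-1) ^ (i - j - t) * of_nat ((i - j) choose t))"
    unfolding sum_distrib_left
    by (rule sum.reindex_bij_witness[of _ "\<lambda>t. t + j" "\<lambda>s. s - j"]) (use assms in auto)
  also have "(\<Sum>t\<le>i - j. (-1) ^ (i - j - t) * of_nat ((i - j) choose t)) = (0 :: rat) ^ (i - j)"
    using binomial_ring[of 1 "-1 :: rat" "i - j"] by (simp add: mult.commute)
  finally show ?thesis
    using assms by auto
qed

text \<open>After exchanging the sums, the coefficient of \<open>h j\<close> is the Kronecker delta
  from \<open>sum_choose_mult_choose\<close>.\<close>

lemma binomial_inversion:
  assumes "\<And>s. e s = (\<Sum>j\<le>s. scale (of_nat (s choose j)) (h j))"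
  shows "h i = (\<Sum>s\<le>i. scale ((-1) ^ (i - s) * of_nat (i choose s)) (e s))"
proof -
  have "(\<Sum>s\<le>i. scale ((-1) ^ (i - s) * of_nat (i choose s)) (e s)) =
      (\<Sum>s\<in>{..i}. \<Sum>j | j \<in> {..i} \<and> j \<le> s.
         scale ((-1) ^ (i - s) * of_nat (i choose s) * of_nat (s choose j)) (h j))"
  proof (intro sum.cong refl)
    fix s assume "s \<in> {..i}"
    then have "{j. j \<in> {..i} \<and> j \<le> s} = {..s}"
      by auto
    then show "scale ((-1) ^ (i - s) * of_nat (i choose s)) (e s) =
        (\<Sum>j | j \<in> {..i} \<and> j \<le> s.
         scale ((-1) ^ (i - s) * of_nat (i choose s) * of_nat (s choose j)) (h j))"
      by (simp add: assms scale_sum_right)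
  qed
  also have "\<dots> = (\<Sum>j\<in>{..i}. \<Sum>s | s \<in> {..i} \<and> j \<le> s.
      scale ((-1) ^ (i - s) * of_nat (i choose s) * of_nat (s choose j)) (h j))"
    by (intro sum.swap_restrict) auto
  also have "\<dots> = (\<Sum>j\<in>{..i}. if j = i then h i else 0)"
  proof (intro sum.cong refl)
    fix j assume j: "j \<in> {..i}"
    have "{s. s \<in> {..i} \<and> j \<le> s} = {j..i}"
      by auto
    then have "(\<Sum>s | s \<in> {..i} \<and> j \<le> s.
        scale ((-1) ^ (i - s) * of_nat (i choose s) * of_nat (s choose j)) (h j)) =
        scale (\<Sum>s=j..i. (-1) ^ (i - s) * of_nat (i choose s) * of_nat (s choose j)) (h j)"
      by (simp add: scale_sum_left)
    then show "(\<Sum>s | s \<in> {..i} \<and> j \<le> s.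
        scale ((-1) ^ (i - s) * of_nat (i choose s) * of_nat (s choose j)) (h j)) =
        (if j = i then h i else 0)"
      using j by (simp add: sum_choose_mult_choose)
  qed
  also have "\<dots> = h i"
    by simp
  finally show ?thesis ..
qed

text \<open>This turns the representation by \<open>D\<close> into the one by \<open>e\<close>. With
  \<open>s = i - k\<close> and \<open>N = n + 1\<close>, it rests on \<open>(N choose s) * ((N - s)
  choose (i - s)) = (N choose i) * (i choose s)\<close>.\<close>

lemma alternating_scaled_sum_eq:
  assumes "i \<le> n"
    and D: "\<And>s. s \<le> n \<Longrightarrow> D (n - s) = scale ((-1) ^ s * of_nat ((n + 1) choose s)) (e s)"
  shows "scale ((-1) ^ i) (\<Sum>k=0..i. scale (of_nat ((n + 1 - i + k) choose k)) (D (n - i + k))) =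
    scale (of_nat ((n + 1) choose i))
      (\<Sum>s\<le>i. scale ((-1) ^ (i - s) * of_nat (i choose s)) (e s))"
  unfolding scale_sum_right
proof (rule sum.reindex_bij_witness[of _ "\<lambda>s. i - s" "\<lambda>k. i - k"])
  fix k assume k: "k \<in> {0..i}"
  define s where "s = i - k"
  have s: "s \<le> i" "k = i - s" "n + 1 - i + k = n + 1 - s" "n - i + k = n - s"
    using k assms(1) by (auto simp: s_def)
  have choose: "of_nat ((n + 1) choose i) * of_nat (i choose s) =
      (of_nat ((n + 1) choose s) * of_nat ((n + 1 - s) choose (i - s)) :: rat)"
    using s assms(1) by (simp only: of_nat_mult[symmetric]) (subst choose_mult; simp)
  have sign: "(-1) ^ i * (-1) ^ s = ((-1) ^ (i - s) :: rat)"
    using s by (simp add: minus_one_power_iff)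
  have "(-1) ^ i * of_nat ((n + 1 - s) choose (i - s)) *
      ((-1) ^ s * of_nat ((n + 1) choose s)) = ((-1) ^ i * (-1) ^ s) *
      (of_nat ((n + 1) choose s) * of_nat ((n + 1 - s) choose (i - s)) :: rat)"
    by (simp only: mult_ac)
  also have "\<dots> = of_nat ((n + 1) choose i) * ((-1) ^ (i - s) * of_nat (i choose s))"
    unfolding sign choose[symmetric] by (simp only: mult_ac)
  finally show "scale (of_nat ((n + 1) choose i))
        (scale ((-1) ^ (i - (i - k)) * of_nat (i choose (i - k))) (e (i - k))) =
      scale ((-1) ^ i) (scale (of_nat ((n + 1 - i + k) choose k)) (D (n - i + k)))"
    unfolding s_def[symmetric] s(3,4) using D[of s] s(1) assms(1)
    unfolding s(2) by (simp add: mult.assoc)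
qed auto

section \<open>The functional equation as a family of order bounds\<close>

lemma functional_equation_iff_diffop:
  fixes f e :: "nat \<Rightarrow> 'a \<Rightarrow> 'a"
  assumes e1: "\<And>s. e s 1 = 0"
    and f: "\<And>i x. i \<le> n \<Longrightarrow> f (n + 1 - i) x = scale (of_nat ((n + 1) choose i))
      (\<Sum>s\<le>i. scale ((-1) ^ (i - s) * of_nat (i choose s)) (e s x))"
  shows "(\<forall>x :: nat \<Rightarrow> 'a.
      (\<Sum>i=0..n. scale (1 / of_nat ((n+1) choose i))
         (\<Sum>I | I \<subseteq> {1..n+1} \<and> card I = i.
            (\<Prod>j\<in>I. x j) * f (n+1-i) (\<Prod>k\<in>{1..n+1}-I. x k))) = 0) \<longleftrightarrow>
    (\<forall>s\<le>n. diffop (n + 1 - s) (e s))"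
proof -
  let ?A = "{1..n+1}"
  \<comment> \<open>The weight \<open>1 / ((n + 1) choose i)\<close> cancels the factor in
    \<open>f (n + 1 - i)\<close>, leaving \<open>h i\<close>.\<close>
  define h where "h i z = (\<Sum>s\<le>i. scale ((-1) ^ (i - s) * of_nat (i choose s)) (e s z))" for i z
  have "(\<Sum>i=0..n. scale (1 / of_nat ((n+1) choose i))
         (\<Sum>I | I \<subseteq> ?A \<and> card I = i. prod x I * f (n+1-i) (prod x (?A - I)))) =
      (\<Sum>S\<in>Pow ?A. prod x S * commutator x (?A - S) (e (card S)) 1)" for x
  proof -
    have "(\<Sum>i=0..n. scale (1 / of_nat ((n+1) choose i))
         (\<Sum>I | I \<subseteq> ?A \<and> card I = i. prod x I * f (n+1-i) (prod x (?A - I)))) =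
      (\<Sum>i=0..n. \<Sum>I | I \<in> Pow ?A - {?A} \<and> card I = i. prod x I * h (card I) (prod x (?A - I)))"
    proof (intro sum.cong refl)
      fix i assume i: "i \<in> {0..n}"
      then have "{I. I \<subseteq> ?A \<and> card I = i} = {I. I \<in> Pow ?A - {?A} \<and> card I = i}"
        by auto
      moreover have "((n + 1) choose i) \<noteq> 0"
        using i by (simp add: binomial_eq_0_iff)
      ultimately show "scale (1 / of_nat ((n+1) choose i))
          (\<Sum>I | I \<subseteq> ?A \<and> card I = i. prod x I * f (n+1-i) (prod x (?A - I))) =
          (\<Sum>I | I \<in> Pow ?A - {?A} \<and> card I = i. prod x I * h (card I) (prod x (?A - I)))"
        using i f[of i] by (simp add: h_def mult_scale_right flip: scale_sum_right)
    qed
    also have "\<dots> = (\<Sum>I\<in>Pow ?A - {?A}. prod x I * h (card I) (prod x (?A - I)))"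
    proof (rule sum.group)
      show "card ` (Pow ?A - {?A}) \<subseteq> {0..n}"
      proof (rule image_subsetI)
        fix I assume "I \<in> Pow ?A - {?A}"
        then have "card I < card ?A"
          by (intro psubset_card_mono) auto
        then show "card I \<in> {0..n}"
          by simp
      qed
    qed auto
    \<comment> \<open>The outer sum stops at \<open>n\<close> and omits the full set; adding it is
      harmless, since its product over the complement is 1 and every \<open>e s\<close> vanishes
      there.\<close>
    also have "\<dots> = (\<Sum>I\<in>Pow ?A. prod x I * h (card I) (prod x (?A - I)))"
      by (rule sum.mono_neutral_left) (auto simp: h_def e1)
    finally show ?thesis
      by (simp add: sum_commutators_eq h_def)
  qed
  then show ?thesis
    using sum_commutators_eq_0_iff[of ?A e] e1 by (simp add: less_Suc_eq_le)
qed

end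

section \<open>Passage between the maps \<open>e s\<close> and higher order derivations\<close>

theorem theorem5:
  fixes scale :: "rat \<Rightarrow> 'a::{comm_ring, comm_monoid_mult} \<Rightarrow> 'a"
    and n :: nat
    and f :: "nat \<Rightarrow> 'a \<Rightarrow> 'a"
  assumes "vector_space scale"
    and "n \<ge> 1"
    and "\<And>i. i \<in> {1..n+1} \<Longrightarrow> additive (f i)"
    and "\<And>i. i \<in> {1..n+1} \<Longrightarrow> f i 1 = 0"
  shows
    "(\<forall>x :: nat \<Rightarrow> 'a.
        (\<Sum>i=0..n. scale (1 / of_nat ((n+1) choose i))
           (\<Sum>I | I \<subseteq> {1..n+1} \<and> card I = i.
              (\<Prod>j\<in>I. x j) * f (n+1-i) (\<Prod>k\<in>{1..n+1}-I. x k))) = 0)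
     \<longleftrightarrow>
     (\<exists>D :: nat \<Rightarrow> 'a \<Rightarrow> 'a.
        (\<forall>j\<in>{0..n}. D j \<in> derivations j) \<and>
        (\<forall>i\<in>{0..n}. \<forall>x. f (n+1-i) x =
           scale ((-1)^i)
             (\<Sum>k=0..i. scale (of_nat ((n+1-i+k) choose k)) (D (n-i+k) x))))"
proof -
  interpret linear_ring scale
    by (intro linear_ring.intro assms(1))
  show ?thesis (is "?L \<longleftrightarrow> ?R")
  proof
    assume L: ?L
    define h where "h i x = scale (1 / of_nat ((n + 1) choose i)) (f (n + 1 - i) x)" for i x
    \<comment> \<open>The binomial transform of \<open>h\<close>. It is cut off beyond
      \<open>n\<close>, where \<open>f 0\<close> would enter, so that \<open>e s 1 = 0\<close> holds
      for every \<open>s\<close>.\<close>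
    define e where "e s x = (if s \<le> n then \<Sum>j\<le>s. scale (of_nat (s choose j)) (h j x) else 0)" for s x
    have f_eq: "f (n + 1 - i) x = scale (of_nat ((n + 1) choose i))
        (\<Sum>s\<le>i. scale ((-1) ^ (i - s) * of_nat (i choose s)) (e s x))" if "i \<le> n" for i x
    proof -
      have "h i x = (\<Sum>s\<le>i. scale ((-1) ^ (i - s) * of_nat (i choose s))
          (\<Sum>j\<le>s. scale (of_nat (s choose j)) (h j x)))"
        by (rule binomial_inversion) simp
      also have "\<dots> = (\<Sum>s\<le>i. scale ((-1) ^ (i - s) * of_nat (i choose s)) (e s x))"
        using that by (intro sum.cong) (auto simp: e_def)
      finally have "scale (of_nat ((n + 1) choose i)) (h i x) = scale (of_nat ((n + 1) choose i))
          (\<Sum>s\<le>i. scale ((-1) ^ (i - s) * of_nat (i choose s)) (e s x))"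
        by simp
      moreover have "((n + 1) choose i) \<noteq> 0"
        using that by (simp add: binomial_eq_0_iff)
      ultimately show ?thesis
        by (simp add: h_def)
    qed
    have e1: "e s 1 = 0" for s
      using assms(4) by (auto simp: e_def h_def intro!: sum.neutral)
    \<comment> \<open>The index exceeds the order by one: \<open>n + 1 - s = Suc (n - s)\<close>
      encodes order at most \<open>n - s\<close>.\<close>
    have diffop: "diffop (n + 1 - s) (e s)" if "s \<le> n" for s
      using functional_equation_iff_diffop[of e n f, OF e1 f_eq] L that by blast
    have deriv: "e s \<in> derivations (n - s)" if s: "s \<le> n" for s
    proof -
      have "additive (h j)" if "j \<le> n" for j
        unfolding h_def using that by (intro additive_scale_comp assms(3)) auto
      then have "additive (\<lambda>x. \<Sum>j\<le>s. scale (of_nat (s choose j)) (h j x))"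
        using s by (intro additive_sum_maps additive_scale_comp) auto
      then have "additive (e s)"
        using s by (simp add: e_def additive_def)
      then show ?thesis
        using e1 diffop[OF s] s
        by (simp add: derivations_def derivation_of_order_iff_diffop Suc_diff_le del: diffop.simps)
    qed
    define D where "D j = (\<lambda>x. scale ((-1) ^ (n - j) * of_nat ((n + 1) choose (n - j))) (e (n - j) x))" for j
    have "D j \<in> derivations j" if "j \<le> n" for j
      using derivations_scale[OF deriv[of "n - j"]] that by (simp add: D_def)
    moreover have "f (n+1-i) x =
           scale ((-1)^i)
             (\<Sum>k=0..i. scale (of_nat ((n+1-i+k) choose k)) (D (n-i+k) x))" if "i \<le> n" for i x
      using alternating_scaled_sum_eq[of i n "\<lambda>j. D j x" "\<lambda>s. e s x"] f_eq that by (simp add: D_def)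
    ultimately show ?R
      by (intro exI[of _ D]) auto
  next
    assume ?R
    then obtain D where D: "\<forall>j\<in>{0..n}. D j \<in> derivations j"
      and f_D: "\<forall>i\<in>{0..n}. \<forall>x. f (n+1-i) x = scale ((-1)^i)
             (\<Sum>k=0..i. scale (of_nat ((n+1-i+k) choose k)) (D (n-i+k) x))"
      by blast
    \<comment> \<open>For \<open>s \<le> n\<close> the coefficient of \<open>e s\<close> in
      \<open>D (n - s)\<close> is nonzero, so it can be divided out; the value 0 beyond
      \<open>n\<close> keeps \<open>e s 1 = 0\<close> for all \<open>s\<close>.\<close>
    define e where "e s = (\<lambda>x. if s \<le> n
        then scale (1 / ((-1) ^ s * of_nat ((n + 1) choose s))) (D (n - s) x) else 0)" for s
    have D_e: "D (n - s) x = scale ((-1) ^ s * of_nat ((n + 1) choose s)) (e s x)"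
      if "s \<le> n" for s x
    proof -
      have "((n + 1) choose s) \<noteq> 0"
        using that by (simp add: binomial_eq_0_iff)
      then show ?thesis
        using that by (simp add: e_def)
    qed
    have deriv: "e s \<in> derivations (n - s)" if "s \<le> n" for s
      using derivations_scale[of "D (n - s)" "n - s"] D that by (simp add: e_def)
    have e1: "e s 1 = 0" for s
      using deriv[of s]
      by (cases "s \<le> n") (auto simp: derivations_def derivation_of_order_iff_diffop e_def)
    have "f (n + 1 - i) x = scale (of_nat ((n + 1) choose i))
        (\<Sum>s\<le>i. scale ((-1) ^ (i - s) * of_nat (i choose s)) (e s x))" if "i \<le> n" for i x
      using alternating_scaled_sum_eq[of i n "\<lambda>j. D j x" "\<lambda>s. e s x", OF that D_e] f_D that by simp
    moreover have "diffop (n + 1 - s) (e s)" if "s \<le> n" for s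
      using deriv[OF that] that
      by (simp add: derivations_def derivation_of_order_iff_diffop Suc_diff_le del: diffop.simps)
    ultimately show ?L
      using functional_equation_iff_diffop[of e n f, OF e1] by blast
  qed
qed

end
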